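(* Let $S$ be a numerical semigroup. Then $S$ is an almost symmetric numerical semigroup with maximal reduced type if and only if one of the following conditions holds: (1) $S$ is a half-line; (2) $S$ is symmetric; (3) there exist integers $t,m$ such that $2\le t<m$ and $S=\Delta(m)\setminus\{2m-t\}$.
   Context: $\mathbb{N}=\{z\in\mathbb{Z}\mid z\ge 0\}$. A numerical semigroup is a submonoid $S$ of $(\mathbb{N},+)$ (containing $0$) with $\mathbb{N}\setminus S$ finite. The multiplicity $\mathrm{m}(S)$ is the smallest element of $S\setminus\{0\}$; the Frobenius number $\mathrm{F}(S)$ is the largest element of $\mathbb{Z}\setminus S$; the genus $\mathrm{g}(S)$ is the cardinality of $\mathbb{N}\setminus S$. The set of pseudo-Frobenius numbers is $\mathrm{PF}(S)=\{x\in\mathbb{Z}\setminus S\mid x+s\in S\text{ for all }0\ne s\in S\}$, and the type $\mathrm{t}(S)$ is its cardinality. $S$ is symmetric if $\mathrm{t}(S)=1$. $S$ is almost symmetric if $\mathrm{g}(S)=\frac{\mathrm{F}(S)+\mathrm{t}(S)}{2}$. Put $\mathrm{rPF}(S)=\{x\in\mathbb{Z}\setminus S\mid \mathrm{F}(S)-\mathrm{m}(S)+1\le x\le \mathrm{F}(S)\}$ and let $s(S)$ be its cardinality (the reduced type); $S$ has maximal reduced type if $s(S)=\mathrm{t}(S)$. For a positive integer $m$, $\Delta(m)=\{x\in\mathbb{N}\mid x\ge m\}\cup\{0\}$; a half-line is a numerical semigroup of the form $\Delta(m)$ for some positive integer $m$. *)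

theory Defs
  imports Complex_Main
begin

text \<open>
  Numerical semigroups are represented as sets of integers contained in the nonnegative integers.
  This way Frobenius and pseudo-Frobenius numbers, which may be negative, live in the same type:
  for \<open>S = {0..}\<close> the Frobenius number is \<open>-1\<close> and the set of pseudo-Frobenius numbers is \<open>{-1}\<close>.
\<close>

definition numerical_semigroup :: "int set \<Rightarrow> bool" where
  "numerical_semigroup S \<longleftrightarrow>
     S \<subseteq> {0..} \<and> 0 \<in> S \<and> (\<forall>x\<in>S. \<forall>y\<in>S. x + y \<in> S) \<and> finite ({0..} - S)"

definition multiplicity :: "int set \<Rightarrow> int" where
  "multiplicity S = (LEAST x. x \<in> S - {0})"

definition Frobenius :: "int set \<Rightarrow> int" where
  "Frobenius S = (GREATEST x. x \<notin> S)"

definition genus :: "int set \<Rightarrow> nat" where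
  "genus S = card ({0..} - S)"

definition PF :: "int set \<Rightarrow> int set" where
  "PF S = {x. x \<notin> S \<and> (\<forall>s\<in>S. s \<noteq> 0 \<longrightarrow> x + s \<in> S)}"

definition semigroup_type :: "int set \<Rightarrow> nat" where
  "semigroup_type S = card (PF S)"

definition symmetric :: "int set \<Rightarrow> bool" where
  "symmetric S \<longleftrightarrow> semigroup_type S = 1"

definition almost_symmetric :: "int set \<Rightarrow> bool" where
  "almost_symmetric S \<longleftrightarrow>
     real (genus S) = (real_of_int (Frobenius S) + real (semigroup_type S)) / 2"

definition rPF :: "int set \<Rightarrow> int set" where
  "rPF S = {x. x \<notin> S \<and> Frobenius S - multiplicity S + 1 \<le> x \<and> x \<le> Frobenius S}"

definition reduced_type :: "int set \<Rightarrow> nat" where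
  "reduced_type S = card (rPF S)"

definition maximal_reduced_type :: "int set \<Rightarrow> bool" where
  "maximal_reduced_type S \<longleftrightarrow> reduced_type S = semigroup_type S"

definition Delta :: "int \<Rightarrow> int set" where
  "Delta m = {x. x \<ge> 0 \<and> x \<ge> m} \<union> {0}"

definition half_line :: "int set \<Rightarrow> bool" where
  "half_line S \<longleftrightarrow> numerical_semigroup S \<and> (\<exists>m>0. S = Delta m)"

end

theory Submission
  imports Defs
begin

text \<open>
  Write \<open>F\<close> and \<open>m\<close> for the Frobenius number and the multiplicity of
  \<open>S\<close>. A gap is an integer outside \<open>S\<close>. The proof rests on the reflection \<open>x
  \<mapsto> F - x\<close>. This reflection sends elements of \<open>S\<close> to gaps, since \<open>F\<close>
  would otherwise be a sum of two elements of \<open>S\<close>; the gaps that it sends to gaps again form a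
  set \<open>L\<close> (the gaps of the second kind). There is a sandwich
  \[ \mathrm{rPF}(S) - \{F\} \subseteq \mathrm{PF}(S) - \{F\} \subseteq L. \]
  Equality on the left is maximal reduced type. Counting nonnegative gaps by means of the reflection gives
  \<open>2 g = F + 1 + card L\<close>, so equality on the right is almost symmetry. Both properties together
  hold iff the outer sets agree, that is, iff every element of \<open>L\<close> exceeds \<open>F - m\<close>
  (\<open>almost_symmetric_maximal_iff\<close>). Since \<open>L\<close> is invariant under the reflection,
  this places \<open>L\<close> strictly between \<open>F - m\<close> and \<open>m\<close>.

  The three cases of the theorem can now be read off. If \<open>F < m\<close>, then \<open>S\<close> is a half-line. If
  \<open>L\<close> is empty, then \<open>S\<close> is symmetric, and conversely, because the largest element of a nonempty
  \<open>L\<close> is a pseudo-Frobenius number other than \<open>F\<close> (\<open>symmetric_iff\<close>). In the remaining case the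
  interval between \<open>F - m\<close> and \<open>m\<close> is nonempty, so the reflection of any gap \<open>x\<close> with
  \<open>m \<le> x < F\<close> is a positive number below \<open>m\<close>, hence a gap; then \<open>x\<close> lies in \<open>L\<close>, which
  contradicts \<open>x \<ge> m\<close>. So \<open>F\<close> is the only gap above \<open>m\<close>, and \<open>t = 2 * m - F\<close>.
\<close>

lemma Frobenius_eqI:
  assumes "f \<notin> S" "\<And>x. x > f \<Longrightarrow> x \<in> S"
  shows "Frobenius S = f"
  unfolding Frobenius_def using assms by (intro Greatest_equality) (auto intro: leI)

lemma multiplicity_eqI:
  assumes "m \<in> S" "m \<noteq> 0" "\<And>x. x \<in> S \<Longrightarrow> x \<noteq> 0 \<Longrightarrow> m \<le> x"
  shows "multiplicity S = m"
  unfolding multiplicity_def using assms by (intro Least_equality) auto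

text \<open>
  The number \<open>-1\<close> is never in \<open>S\<close>, so the largest integer outside \<open>S\<close> can be found in the finite set
  of gaps enlarged by \<open>-1\<close>. For \<open>S = {0..}\<close> this is the number \<open>-1\<close> itself.
\<close>

lemma Frobenius_props:
  assumes "numerical_semigroup S"
  shows "Frobenius S \<notin> S" "\<And>x. x \<notin> S \<Longrightarrow> x \<le> Frobenius S" "Frobenius S \<ge> -1"
proof -
  define T where "T = insert (-1) ({0..} - S)"
  have fin: "finite T" and ne: "T \<noteq> {}"
    using assms by (auto simp: T_def numerical_semigroup_def)
  have notin: "Max T \<notin> S"
    using Max_in[OF fin ne] assms by (auto simp: T_def numerical_semigroup_def)
  have max: "x \<le> Max T" if "x \<in> T" for x
    using fin that by simp
  have m1: "Max T \<ge> -1"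
    using max[of "-1"] by (simp add: T_def)
  have le: "x \<le> Max T" if "x \<notin> S" for x
  proof (cases "x \<ge> 0")
    case True
    then show ?thesis using max[of x] that by (auto simp: T_def)
  qed (use m1 in auto)
  have "Frobenius S = Max T"
    using notin le by (intro Frobenius_eqI) force+
  then show "Frobenius S \<notin> S" "\<And>x. x \<notin> S \<Longrightarrow> x \<le> Frobenius S" "Frobenius S \<ge> -1"
    using notin le m1 by auto
qed

lemma multiplicity_props:
  assumes "numerical_semigroup S"
  shows "multiplicity S \<in> S" "multiplicity S > 0"
    "\<And>x. x \<in> S \<Longrightarrow> x \<noteq> 0 \<Longrightarrow> multiplicity S \<le> x"
proof -
  define P where "P k \<longleftrightarrow> k > 0 \<and> int k \<in> S" for k
  have nonneg: "x \<ge> 0" if "x \<in> S" for x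
    using assms that by (auto simp: numerical_semigroup_def)
  have "P (nat (max 1 (Frobenius S + 1)))"
    using Frobenius_props(2)[OF assms, of "max 1 (Frobenius S + 1)"] by (auto simp: P_def)
  then have P: "P (Least P)"
    by (rule LeastI)
  have le: "int (Least P) \<le> x" if "x \<in> S" "x \<noteq> 0" for x
  proof -
    have "P (nat x)" using nonneg[OF that(1)] that by (simp add: P_def)
    then have "Least P \<le> nat x" by (rule Least_le)
    then show ?thesis using nonneg[OF that(1)] by simp
  qed
  have "multiplicity S = int (Least P)"
    using P le by (intro multiplicity_eqI) (auto simp: P_def)
  then show "multiplicity S \<in> S" "multiplicity S > 0"
    "\<And>x. x \<in> S \<Longrightarrow> x \<noteq> 0 \<Longrightarrow> multiplicity S \<le> x"
    using P le by (auto simp: P_def)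
qed

text \<open>
  No bounds on \<open>x\<close> are imposed: both \<open>x\<close> and its mirror image are at most the Frobenius number, so
  both are also nonnegative.
\<close>

definition second_kind_gaps :: "int set \<Rightarrow> int set" where
  "second_kind_gaps S = {x. x \<notin> S \<and> Frobenius S - x \<notin> S}"

lemma second_kind_gaps_reflect:
  "x \<in> second_kind_gaps S \<Longrightarrow> Frobenius S - x \<in> second_kind_gaps S"
  by (auto simp: second_kind_gaps_def)

lemma second_kind_gaps_bounds:
  assumes "numerical_semigroup S" "x \<in> second_kind_gaps S"
  shows "0 < x" "x < Frobenius S"
proof -
  have "0 \<in> S" using assms by (auto simp: numerical_semigroup_def)
  then have "x \<noteq> 0" "Frobenius S - x \<noteq> 0"
    using assms by (auto simp: second_kind_gaps_def)
  then show "0 < x" "x < Frobenius S"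
    using Frobenius_props(2)[OF assms(1), of x] Frobenius_props(2)[OF assms(1), of "Frobenius S - x"]
      assms(2) by (auto simp: second_kind_gaps_def)
qed

lemma finite_second_kind_gaps:
  assumes "numerical_semigroup S"
  shows "finite (second_kind_gaps S)"
proof (rule finite_subset)
  show "second_kind_gaps S \<subseteq> {0..Frobenius S}"
    using second_kind_gaps_bounds[OF assms] by fastforce
qed simp

text \<open>
  The reflection maps the elements of \<open>S\<close> up to the Frobenius number \<open>F\<close> bijectively onto the
  nonnegative gaps that are not of the second kind, while gaps and elements together fill \<open>{0..F}\<close>.
\<close>

lemma genus_eq:
  assumes "numerical_semigroup S"
  shows "2 * int (genus S) = Frobenius S + 1 + int (card (second_kind_gaps S))"
proof -
  let ?F = "Frobenius S" and ?G = "{0..} - S" and ?L = "second_kind_gaps S"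
  let ?N = "S \<inter> {0..?F}"
  note F = Frobenius_props[OF assms]
  have fin: "finite ?G" using assms by (auto simp: numerical_semigroup_def)
  have add: "x + y \<in> S" if "x \<in> S" "y \<in> S" for x y
    using assms that by (auto simp: numerical_semigroup_def)
  have L0: "x \<ge> 0" if "x \<in> ?L" for x
    using second_kind_gaps_bounds[OF assms that] by simp
  have "{0..?F} = ?G \<union> ?N" using F(2) by auto
  then have "card {0..?F} = card ?G + card ?N"
    using card_Un_disjoint[of ?G ?N] fin by auto
  then have fill: "?F + 1 = int (card ?G) + int (card ?N)"
    using F(3) by simp
  have "?G = ?L \<union> (\<lambda>x. ?F - x) ` ?N"
  proof (intro equalityI subsetI)
    fix x assume x: "x \<in> ?G"
    then have "x \<le> ?F" using F(2) by auto
    show "x \<in> ?L \<union> (\<lambda>x. ?F - x) ` ?N"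
    proof (cases "?F - x \<in> S")
      case True
      then have "?F - x \<in> ?N" using x \<open>x \<le> ?F\<close> by auto
      then have "?F - (?F - x) \<in> (\<lambda>x. ?F - x) ` ?N" by (rule imageI)
      then show ?thesis by simp
    qed (use x in \<open>auto simp: second_kind_gaps_def\<close>)
  next
    fix x assume "x \<in> ?L \<union> (\<lambda>x. ?F - x) ` ?N"
    then show "x \<in> ?G"
      using L0 add[of "?F - x" x] F(1) by (auto simp: second_kind_gaps_def)
  qed
  moreover have "?L \<inter> (\<lambda>x. ?F - x) ` ?N = {}"
    by (auto simp: second_kind_gaps_def)
  ultimately have "card ?G = card ?L + card ((\<lambda>x. ?F - x) ` ?N)"
    using card_Un_disjoint[of ?L "(\<lambda>x. ?F - x) ` ?N"] finite_second_kind_gaps[OF assms] by simp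
  also have "card ((\<lambda>x. ?F - x) ` ?N) = card ?N"
    by (intro card_image) (auto simp: inj_on_def)
  finally show ?thesis
    using fill by (simp add: genus_def)
qed

lemma Frobenius_in_rPF:
  assumes "numerical_semigroup S"
  shows "Frobenius S \<in> rPF S"
  using Frobenius_props(1)[OF assms] multiplicity_props(2)[OF assms] by (simp add: rPF_def)

text \<open>
  A gap above \<open>F - m\<close> is pseudo-Frobenius because adding a nonzero element of \<open>S\<close>, which is at least
  \<open>m\<close>, moves it past the Frobenius number \<open>F\<close>.
\<close>

lemma rPF_subset_PF:
  assumes "numerical_semigroup S"
  shows "rPF S \<subseteq> PF S"
proof
  fix x assume x: "x \<in> rPF S"
  have "x + s \<in> S" if "s \<in> S" "s \<noteq> 0" for s
    using multiplicity_props(3)[OF assms that] Frobenius_props(2)[OF assms, of "x + s"] x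
    by (auto simp: rPF_def)
  then show "x \<in> PF S" using x by (auto simp: PF_def rPF_def)
qed

lemma PF_subset_second_kind_gaps:
  "PF S - {Frobenius S} \<subseteq> second_kind_gaps S" if "numerical_semigroup S"
proof
  fix x assume x: "x \<in> PF S - {Frobenius S}"
  have "Frobenius S - x \<notin> S"
  proof
    assume "Frobenius S - x \<in> S"
    then have "x + (Frobenius S - x) \<in> S"
      using x unfolding PF_def by force
    then show False using Frobenius_props(1)[OF that] by simp
  qed
  then show "x \<in> second_kind_gaps S"
    using x by (auto simp: second_kind_gaps_def PF_def)
qed

lemma finite_PF:
  assumes "numerical_semigroup S"
  shows "finite (PF S)"
proof (rule finite_subset)
  show "PF S \<subseteq> insert (Frobenius S) (second_kind_gaps S)"
    using PF_subset_second_kind_gaps[OF assms] by blast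
  show "finite (insert (Frobenius S) (second_kind_gaps S))"
    using finite_second_kind_gaps[OF assms] by simp
qed

lemma semigroup_type_eq:
  assumes "numerical_semigroup S"
  shows "semigroup_type S = Suc (card (PF S - {Frobenius S}))"
proof -
  have "Frobenius S \<in> PF S"
    using Frobenius_in_rPF[OF assms] rPF_subset_PF[OF assms] by blast
  then show ?thesis
    unfolding semigroup_type_def by (rule card_Suc_Diff1[OF finite_PF[OF assms], symmetric])
qed

text \<open>
  By \<open>genus_eq\<close> almost symmetry compares the cardinalities of two finite sets, one of which contains
  the other.
\<close>

lemma almost_symmetric_iff:
  assumes "numerical_semigroup S"
  shows "almost_symmetric S \<longleftrightarrow> PF S - {Frobenius S} = second_kind_gaps S"
proof -
  let ?L = "second_kind_gaps S" and ?P = "PF S - {Frobenius S}"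
  have "almost_symmetric S \<longleftrightarrow>
      real_of_int (2 * int (genus S)) = real_of_int (Frobenius S + int (semigroup_type S))"
    unfolding almost_symmetric_def by (simp add: eq_divide_eq_numeral1 mult.commute)
  also have "\<dots> \<longleftrightarrow> 2 * int (genus S) = Frobenius S + int (semigroup_type S)"
    by (rule of_int_eq_iff)
  also have "\<dots> \<longleftrightarrow> card ?P = card ?L"
    using genus_eq[OF assms] semigroup_type_eq[OF assms] by linarith
  also have "\<dots> \<longleftrightarrow> ?P = ?L"
    using card_subset_eq[OF finite_second_kind_gaps[OF assms] PF_subset_second_kind_gaps[OF assms]]
    by metis
  finally show ?thesis .
qed

lemma maximal_reduced_type_iff:
  assumes "numerical_semigroup S"
  shows "maximal_reduced_type S \<longleftrightarrow> rPF S = PF S"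
  unfolding maximal_reduced_type_def reduced_type_def semigroup_type_def
  using card_subset_eq[OF finite_PF[OF assms] rPF_subset_PF[OF assms]] by metis

text \<open>
  This is the collapse of the sandwich of \<open>rPF\<close>, \<open>PF\<close> and the gaps of the second kind. The
  inclusion of the last set in the first is the only one that can fail.
\<close>

lemma almost_symmetric_maximal_iff:
  assumes "numerical_semigroup S"
  shows "almost_symmetric S \<and> maximal_reduced_type S \<longleftrightarrow>
    (\<forall>x\<in>second_kind_gaps S. Frobenius S - multiplicity S < x)"
proof -
  have "almost_symmetric S \<and> maximal_reduced_type S \<longleftrightarrow>
      second_kind_gaps S \<subseteq> rPF S - {Frobenius S}"
    unfolding almost_symmetric_iff[OF assms] maximal_reduced_type_iff[OF assms]
    using Frobenius_in_rPF[OF assms] rPF_subset_PF[OF assms] PF_subset_second_kind_gaps[OF assms]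
    by blast
  also have "\<dots> \<longleftrightarrow> (\<forall>x\<in>second_kind_gaps S. x \<in> rPF S - {Frobenius S})"
    by (rule subset_eq)
  also have "\<dots> \<longleftrightarrow> (\<forall>x\<in>second_kind_gaps S. Frobenius S - multiplicity S < x)"
  proof (rule ball_cong[OF refl])
    fix x assume x: "x \<in> second_kind_gaps S"
    then show "x \<in> rPF S - {Frobenius S} \<longleftrightarrow> Frobenius S - multiplicity S < x"
      using second_kind_gaps_bounds(2)[OF assms x] by (auto simp: rPF_def second_kind_gaps_def)
  qed
  finally show ?thesis .
qed

text \<open>
  If \<open>h\<close> is the largest gap of the second kind and \<open>s \<noteq> 0\<close> is in \<open>S\<close>, then \<open>h + s\<close> is not of the
  second kind, by maximality. So if it were a gap, then \<open>F - (h + s)\<close> would lie in \<open>S\<close>, and so would its sum with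
  \<open>s\<close>, which is \<open>F - h\<close>. So \<open>h\<close> is a pseudo-Frobenius number other than \<open>F\<close>.
\<close>

lemma symmetric_iff:
  assumes "numerical_semigroup S"
  shows "symmetric S \<longleftrightarrow> second_kind_gaps S = {}"
proof
  assume "second_kind_gaps S = {}"
  then have PF: "PF S - {Frobenius S} = {}"
    using PF_subset_second_kind_gaps[OF assms] by blast
  show "symmetric S"
    unfolding symmetric_def semigroup_type_eq[OF assms] PF by simp
next
  let ?L = "second_kind_gaps S"
  assume "symmetric S"
  then have PF: "PF S - {Frobenius S} = {}"
    using finite_PF[OF assms] by (simp add: symmetric_def semigroup_type_eq[OF assms])
  show "?L = {}"
  proof (rule ccontr)
    assume ne: "?L \<noteq> {}"
    define h where "h = Max ?L"
    have h: "h \<in> ?L"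
      unfolding h_def using finite_second_kind_gaps[OF assms] ne by (rule Max_in)
    have "h + s \<in> S" if s: "s \<in> S" "s \<noteq> 0" for s
    proof (rule ccontr)
      assume gap: "h + s \<notin> S"
      have "s > 0" using s assms by (force simp: numerical_semigroup_def)
      then have "h + s \<notin> ?L"
        using Max_ge[OF finite_second_kind_gaps[OF assms], of "h + s"] unfolding h_def by auto
      then have "Frobenius S - (h + s) \<in> S"
        using gap by (auto simp: second_kind_gaps_def)
      then have "Frobenius S - (h + s) + s \<in> S"
        using s assms unfolding numerical_semigroup_def by blast
      then show False using h by (simp add: second_kind_gaps_def)
    qed
    then have "h \<in> PF S" using h by (auto simp: PF_def second_kind_gaps_def)
    then show False using PF second_kind_gaps_bounds(2)[OF assms h] by auto
  qed
qed

theorem corollary1: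
  fixes S :: "int set"
  assumes "numerical_semigroup S"
  shows "(almost_symmetric S \<and> maximal_reduced_type S) \<longleftrightarrow>
    half_line S \<or>
    symmetric S \<or>
    (\<exists>t m :: int. 2 \<le> t \<and> t < m \<and> S = Delta m - {2 * m - t})"
proof -
  let ?F = "Frobenius S" and ?m = "multiplicity S" and ?L = "second_kind_gaps S"
  note F = Frobenius_props[OF assms] and M = multiplicity_props[OF assms]
    and L = second_kind_gaps_bounds[OF assms]
  have zero: "0 \<in> S" and nonneg: "\<And>x. x \<in> S \<Longrightarrow> x \<ge> 0"
    using assms by (auto simp: numerical_semigroup_def)
  show ?thesis
    unfolding almost_symmetric_maximal_iff[OF assms]
  proof (intro iffI; (elim disjE exE conjE)?)
    assume low: "\<forall>x\<in>?L. ?F - ?m < x"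
    have high: "x < ?m" if "x \<in> ?L" for x
      using low second_kind_gaps_reflect[OF that] by auto
    consider "?F < ?m" | "?m \<le> ?F" "?L = {}" | "?m \<le> ?F" "?L \<noteq> {}"
      by linarith
    then show "half_line S \<or> symmetric S \<or>
      (\<exists>t m :: int. 2 \<le> t \<and> t < m \<and> S = Delta m - {2 * m - t})"
    proof cases
      case 1
      have "S = Delta ?m"
      proof (intro equalityI subsetI)
        fix x assume "x \<in> S"
        then show "x \<in> Delta ?m" using nonneg M(3) by (auto simp: Delta_def)
      next
        fix x assume "x \<in> Delta ?m"
        then show "x \<in> S" using F(2)[of x] 1 zero by (cases "x \<in> S") (auto simp: Delta_def)
      qed
      then show ?thesis using assms M(2) by (auto simp: half_line_def)
    next
      case 2
      then show ?thesis using symmetric_iff[OF assms] by blast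
    next
      case 3
      then obtain y where y: "y \<in> ?L" by blast
      have ineq: "?F \<le> 2 * ?m - 2"
        using low high y by force
      have "?m \<noteq> ?F" using M(1) F(1) by metis
      then have less: "?m < ?F" using 3 by simp
      have "S = Delta ?m - {?F}"
      proof (intro equalityI subsetI)
        fix x assume "x \<in> S"
        then show "x \<in> Delta ?m - {?F}" using nonneg M(3) F(1) by (auto simp: Delta_def)
      next
        fix x assume x: "x \<in> Delta ?m - {?F}"
        show "x \<in> S"
        proof (rule ccontr)
          assume gap: "x \<notin> S"
          then have "?m \<le> x" "x < ?F" using x zero F(2)[of x] by (auto simp: Delta_def)
          then have "?F - x \<notin> S" using M(3)[of "?F - x"] ineq M(2) by auto
          then have "x \<in> ?L" using gap by (simp add: second_kind_gaps_def)
          then show False using high \<open>?m \<le> x\<close> by force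
        qed
      qed
      then have "S = Delta ?m - {2 * ?m - (2 * ?m - ?F)}" by simp
      moreover have "2 \<le> 2 * ?m - ?F" "2 * ?m - ?F < ?m" using ineq less by auto
      ultimately show ?thesis by blast
    qed
  next
    assume "half_line S"
    then obtain m where m: "m > 0" "S = Delta m" by (auto simp: half_line_def)
    have "?F < ?m"
    proof (rule ccontr)
      assume "\<not> ?F < ?m"
      then show False using m F(1) M(1,2) by (auto simp: Delta_def)
    qed
    then show "\<forall>x\<in>?L. ?F - ?m < x" using L(1) by force
  next
    assume "symmetric S"
    then show "\<forall>x\<in>?L. ?F - ?m < x" using symmetric_iff[OF assms] by auto
  next
    fix t m :: int
    assume tm: "2 \<le> t" "t < m" and S: "S = Delta m - {2 * m - t}"
    have Feq: "?F = 2 * m - t"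
      using tm by (intro Frobenius_eqI) (auto simp: S Delta_def)
    have Meq: "?m = m"
      using tm by (intro multiplicity_eqI) (auto simp: S Delta_def)
    show "\<forall>x\<in>?L. ?F - ?m < x"
    proof (rule ballI, rule ccontr)
      fix x assume x: "x \<in> ?L" and "\<not> ?F - ?m < x"
      \<comment> \<open>then the mirror image of \<open>x\<close> is at least \<open>m\<close> and differs from \<open>F\<close>, so it lies in \<open>S\<close>\<close>
      then have "2 * m - t - x \<in> S"
        using L[OF x] tm unfolding Feq Meq by (auto simp: S Delta_def)
      then show False using x by (simp add: second_kind_gaps_def Feq)
    qed
  qed
qed

end
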